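(* Let $\beta\in(0,1)$ and $t>0$. Then for all $y\in\mathcal N_t^{F_1}(\beta)\cap\mathcal N_t^{F_2}(\beta)$, $$0\le t\sum_{i=1}^2\omega\left(\|x_i^*(y,t)-x_i^c\|_{x_i^c}\right)\le d_0(y)-d(y,t)\le t\sum_{i=1}^2\left[\omega_*\big(\lambda_{F_i}(x_i^*(y,t))\big)+\nu_i\right].$$
   Context: Setting and assumptions. For $i=1,2$: $X_i\subset\mathbb{R}^{n_i}$ is a bounded closed convex set with nonempty interior; $F_i$ is a self-concordant barrier for $X_i$ with parameter $\nu_i$ (standard self-concordant, i.e. $|D^3F_i(x)[h,h,h]|\le 2(h^T\nabla^2F_i(x)h)^{3/2}$, with domain $\mathrm{int}(X_i)$, tending to $+\infty$ at the boundary, and $(\nabla F_i(x)^Th)^2\le\nu_i\,h^T\nabla^2F_i(x)h$); $\phi_i:\mathbb{R}^{n_i}\to\mathbb{R}$ is concave, proper and upper semicontinuous on $X_i$; $A_i\in\mathbb{R}^{m\times n_i}$, $b\in\mathbb{R}^m$, and $A=[A_1,A_2]$ has full row rank. With $X=X_1\times X_2$ and $\phi(x)=\phi_1(x_1)+\phi_2(x_2)$, the problem $\max\{\phi(x): Ax=b,\ x\in X\}$ has a nonempty solution set, and either the Slater condition ($\mathrm{ri}(X)\cap\{Ax=b\}\ne\emptyset$) holds or $X$ is polyhedral. Notation. $x_i^c=\arg\min_{\mathrm{int}(X_i)}F_i$ (analytic center). $d_0(y)=\max_{x\in X}\{\phi(x)+y^T(Ax-b)\}$. For $t>0$: $d_i(y,t)=\max_{x_i\in\mathrm{int}(X_i)}\{\phi_i(x_i)+y^TA_ix_i-t[F_i(x_i)-F_i(x_i^c)]\}$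 with unique maximizer $x_i^*(y,t)$, and $d(y,t)=d_1(y,t)+d_2(y,t)-b^Ty$. Local norms: $\|u\|_{x_i}=(u^T\nabla^2F_i(x_i)u)^{1/2}$, $\|u\|^*_{x_i}=(u^T\nabla^2F_i(x_i)^{-1}u)^{1/2}$. $\lambda_{F_i}(x_i)=\|\nabla F_i(x_i)\|^*_{x_i}$, and $\mathcal N_t^{F_i}(\beta)=\{y\in\mathbb{R}^m : \lambda_{F_i}(x_i^*(y,t))\le\beta\}$. $\omega(s)=s-\ln(1+s)$, $\omega_*(s)=-s-\ln(1-s)$. *)

theory Defs
  imports "HOL-Analysis.Analysis"
begin

definition grad :: "('a::real_inner \<Rightarrow> real) \<Rightarrow> 'a \<Rightarrow> 'a" where
  "grad F x = (THE D. GDERIV F x :> D)"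

definition hessian :: "(real^'n \<Rightarrow> real) \<Rightarrow> real^'n \<Rightarrow> real^'n^'n" where
  "hessian F x = matrix (frechet_derivative (grad F) (at x))"

text \<open>The trilinear form $D^3F(x)[u,v,w]$: the Hessian form at $(u,v)$, differentiated
  in direction $w$.\<close>

definition third_deriv ::
    "(real^'n \<Rightarrow> real) \<Rightarrow> real^'n \<Rightarrow> real^'n \<Rightarrow> real^'n \<Rightarrow> real^'n \<Rightarrow> real" where
  "third_deriv F x u v w = u \<bullet> (frechet_derivative (hessian F) (at x) w *v v)"

text \<open>Intended for open \<open>S\<close>, where the derivatives at points of \<open>S\<close> depend only on
  the values of \<open>F\<close> in \<open>S\<close>.\<close>

definition C3_on :: "(real^'n) set \<Rightarrow> (real^'n \<Rightarrow> real) \<Rightarrow> bool" where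
  "C3_on S F \<longleftrightarrow>
     (\<forall>x\<in>S. F differentiable (at x) \<and> grad F differentiable (at x)
            \<and> hessian F differentiable (at x)) \<and>
     (\<forall>u v w. continuous_on S (\<lambda>x. third_deriv F x u v w))"

text \<open>As usual, self-concordance includes convexity (so the base of the power below is
  nonnegative) and three times continuous differentiability.\<close>

definition self_concordant_on :: "(real^'n) set \<Rightarrow> (real^'n \<Rightarrow> real) \<Rightarrow> bool" where
  "self_concordant_on S F \<longleftrightarrow>
     convex_on S F \<and> C3_on S F \<and>
     (\<forall>x\<in>S. \<forall>h. \<bar>third_deriv F x h h h\<bar> \<le> 2 * (h \<bullet> (hessian F x *v h)) powr (3/2))"

text \<open>Functions are total, so the effective domain is rendered by using \<open>F\<close> only on
  \<open>interior X\<close>; its values elsewhere are irrelevant.\<close>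

definition self_concordant_barrier ::
    "(real^'n) set \<Rightarrow> real \<Rightarrow> (real^'n \<Rightarrow> real) \<Rightarrow> bool" where
  "self_concordant_barrier X \<nu> F \<longleftrightarrow>
     self_concordant_on (interior X) F \<and>
     (\<forall>x\<in>frontier X. filterlim F at_top (at x within interior X)) \<and>
     (\<forall>x\<in>interior X. \<forall>h. (grad F x \<bullet> h)\<^sup>2 \<le> \<nu> * (h \<bullet> (hessian F x *v h)))"

definition upper_semicontinuous_on :: "'a::topological_space set \<Rightarrow> ('a \<Rightarrow> real) \<Rightarrow> bool" where
  "upper_semicontinuous_on S f \<longleftrightarrow>
     (\<forall>x\<in>S. \<forall>e>0. \<forall>\<^sub>F z in at x within S. f z < f x + e)"

definition hcat :: "real^'n1^'m \<Rightarrow> real^'n2^'m \<Rightarrow> real^('n1 + 'n2)^'m" where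
  "hcat A1 A2 = (\<chi> i j. case j of Inl k \<Rightarrow> A1 $ i $ k | Inr k \<Rightarrow> A2 $ i $ k)"

definition analytic_center :: "(real^'n) set \<Rightarrow> (real^'n \<Rightarrow> real) \<Rightarrow> real^'n" where
  "analytic_center X F = arg_min_on F (interior X)"

definition local_norm :: "(real^'n \<Rightarrow> real) \<Rightarrow> real^'n \<Rightarrow> real^'n \<Rightarrow> real" where
  "local_norm F x u = sqrt (u \<bullet> (hessian F x *v u))"

definition dual_local_norm :: "(real^'n \<Rightarrow> real) \<Rightarrow> real^'n \<Rightarrow> real^'n \<Rightarrow> real" where
  "dual_local_norm F x u = sqrt (u \<bullet> (matrix_inv (hessian F x) *v u))"

definition newton_decrement :: "(real^'n \<Rightarrow> real) \<Rightarrow> real^'n \<Rightarrow> real" where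
  "newton_decrement F x = dual_local_norm F x (grad F x)"

text \<open>Maximum of \<open>f\<close> over \<open>S\<close>, as an attained value.\<close>

definition max_over :: "'a set \<Rightarrow> ('a \<Rightarrow> real) \<Rightarrow> real" where
  "max_over S f = (GREATEST v. v \<in> f ` S)"

definition dual_fun ::
    "(real^'n1) set \<Rightarrow> (real^'n2) set \<Rightarrow> (real^'n1 \<Rightarrow> real) \<Rightarrow> (real^'n2 \<Rightarrow> real) \<Rightarrow>
     real^'n1^'m \<Rightarrow> real^'n2^'m \<Rightarrow> real^'m \<Rightarrow> real^'m \<Rightarrow> real" where
  "dual_fun X1 X2 \<phi>1 \<phi>2 A1 A2 b y =
     max_over (X1 \<times> X2)
       (\<lambda>(x1, x2). \<phi>1 x1 + \<phi>2 x2 + y \<bullet> (A1 *v x1 + A2 *v x2 - b))"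

definition smoothed_objective ::
    "(real^'n) set \<Rightarrow> (real^'n \<Rightarrow> real) \<Rightarrow> (real^'n \<Rightarrow> real) \<Rightarrow> real^'n^'m \<Rightarrow>
     real^'m \<Rightarrow> real \<Rightarrow> real^'n \<Rightarrow> real" where
  "smoothed_objective X F \<phi> A y t x =
     \<phi> x + y \<bullet> (A *v x) - t * (F x - F (analytic_center X F))"

definition smoothed_dual_component ::
    "(real^'n) set \<Rightarrow> (real^'n \<Rightarrow> real) \<Rightarrow> (real^'n \<Rightarrow> real) \<Rightarrow> real^'n^'m \<Rightarrow>
     real^'m \<Rightarrow> real \<Rightarrow> real" where
  "smoothed_dual_component X F \<phi> A y t =
     max_over (interior X) (smoothed_objective X F \<phi> A y t)"

definition smoothed_maximizer ::
    "(real^'n) set \<Rightarrow> (real^'n \<Rightarrow> real) \<Rightarrow> (real^'n \<Rightarrow> real) \<Rightarrow> real^'n^'m \<Rightarrow>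
     real^'m \<Rightarrow> real \<Rightarrow> real^'n" where
  "smoothed_maximizer X F \<phi> A y t =
     arg_max_on (smoothed_objective X F \<phi> A y t) (interior X)"

definition smoothed_dual ::
    "(real^'n1) set \<Rightarrow> (real^'n2) set \<Rightarrow> (real^'n1 \<Rightarrow> real) \<Rightarrow> (real^'n2 \<Rightarrow> real) \<Rightarrow>
     (real^'n1 \<Rightarrow> real) \<Rightarrow> (real^'n2 \<Rightarrow> real) \<Rightarrow>
     real^'n1^'m \<Rightarrow> real^'n2^'m \<Rightarrow> real^'m \<Rightarrow> real^'m \<Rightarrow> real \<Rightarrow> real" where
  "smoothed_dual X1 X2 F1 F2 \<phi>1 \<phi>2 A1 A2 b y t =
     smoothed_dual_component X1 F1 \<phi>1 A1 y t
     + smoothed_dual_component X2 F2 \<phi>2 A2 y t - b \<bullet> y"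

definition center_nbhd ::
    "(real^'n) set \<Rightarrow> (real^'n \<Rightarrow> real) \<Rightarrow> (real^'n \<Rightarrow> real) \<Rightarrow> real^'n^'m \<Rightarrow>
     real \<Rightarrow> real \<Rightarrow> (real^'m) set" where
  "center_nbhd X F \<phi> A t \<beta> =
     {y. newton_decrement F (smoothed_maximizer X F \<phi> A y t) \<le> \<beta>}"

definition omega :: "real \<Rightarrow> real" where
  "omega s = s - ln (1 + s)"

definition omega_star :: "real \<Rightarrow> real" where
  "omega_star s = - s - ln (1 - s)"

end

theory Submission
  imports Defs
begin

text \<open>
  For a fixed multiplier \<open>y\<close> both dual functions split over the two blocks, so the argument concerns
  one block \<open>X, F, \<nu>, \<phi>, A\<close>. Put \<open>g x = \<phi> x + y \<bullet> (A *v x)\<close>, let \<open>m\<close> maximize \<open>g\<close> over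
  \<open>X\<close>, \<open>xs\<close> maximize \<open>g - t F\<close> over the interior, and \<open>xc\<close> be the analytic center. The block
  contributes
    \<open>(g m - g xs) + t (F xs - F xc)\<close>
  to the gap. Both summands are nonnegative, and each is controlled by one property of the barrier.

  The summand \<open>F xs - F xc\<close> is sandwiched by self-concordance. Along a segment the curvature
  \<open>\<psi>\<close> of \<open>F\<close> satisfies \<open>\<bar>\<psi>'\<bar> \<le> 2 \<psi> powr (3/2)\<close>, that is, \<open>1 / sqrt \<psi>\<close> is 1-Lipschitz;
  integrating twice gives \<open>F x + grad F x \<bullet> (z - x) + omega (\<parallel>z - x\<parallel>\<^sub>x) \<le> F z\<close>
  (\<open>self_concordant_lower_bound\<close>). With \<open>x = xc\<close>, where the gradient vanishes, this is the lower
  bound of the theorem. With \<open>x = xs\<close>, \<open>z = xc\<close> and the Cauchy-Schwarz inequality of the local norm,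
  it yields \<open>F xs - F xc \<le> \<lambda> r - omega r\<close> for some \<open>r \<ge> 0\<close>, where \<open>\<lambda> < 1\<close> is the Newton
  decrement; since \<open>omega_star\<close> is the convex conjugate of \<open>omega\<close>, the right-hand side is at most
  \<open>omega_star \<lambda>\<close> (\<open>barrier_gap_le_omega_star\<close>).

  The summand \<open>g m - g xs\<close> is controlled by the barrier parameter. Optimality of \<open>xs\<close> together with
  concavity of \<open>g\<close> on the segment from \<open>xs\<close> to \<open>m\<close> gives
  \<open>g m - g xs \<le> t (grad F xs \<bullet> (m - xs))\<close>, and the slope of a \<open>\<nu>\<close>-barrier towards any point of
  the body is at most \<open>\<nu>\<close> (\<open>grad_inner_le_parameter\<close>, \<open>penalized_maximizer_gap\<close>).

  Two facts about the Hessian are needed so that the Newton decrement is the dual norm of the gradient.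
  It is symmetric, by the classical argument with second differences
  (\<open>gradient_derivative_symmetric\<close>), and positive definite, because a direction of zero curvature
  would make \<open>F\<close> affine on a ray that reaches the boundary of the bounded body, where \<open>F\<close> is
  unbounded (\<open>hessian_positive_definite\<close>).
\<close>

section \<open>Self-concordance on an interval\<close>

text \<open>On the compact interval the function is bounded, so the power \<open>3/2\<close> may be replaced by a constant
  multiple of \<open>\<psi>\<close> and the standard exponential comparison applies on both sides. The lower bound keeps
  \<open>\<psi>\<close> positive if it starts positive, which makes \<open>1 / sqrt \<psi>\<close> meaningful; the upper bound
  propagates a zero of \<open>\<psi>\<close>, hence a degenerate direction of the Hessian, along the line.\<close>

lemma gronwall_nonneg:
  fixes \<psi> \<psi>' :: "real \<Rightarrow> real"
  assumes b: "0 \<le> b"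
    and deriv: "\<And>s. 0 \<le> s \<Longrightarrow> s \<le> b \<Longrightarrow> (\<psi> has_real_derivative \<psi>' s) (at s)"
    and nonneg: "\<And>s. 0 \<le> s \<Longrightarrow> s \<le> b \<Longrightarrow> 0 \<le> \<psi> s"
    and bound: "\<And>s. 0 \<le> s \<Longrightarrow> s \<le> b \<Longrightarrow> \<bar>\<psi>' s\<bar> \<le> 2 * \<psi> s powr (3/2)"
  obtains K where "\<psi> 0 * exp (- K * b) \<le> \<psi> b" "\<psi> b \<le> \<psi> 0 * exp (K * b)"
proof -
  have "continuous_on {0..b} \<psi>"
    by (rule DERIV_continuous_on[where D = \<psi>'], rule has_field_derivative_at_within, rule deriv) auto
  then obtain m where "\<forall>s\<in>{0..b}. \<psi> s \<le> \<psi> m"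
    using continuous_attains_sup[of "{0..b}" \<psi>] b by auto
  then have M: "\<psi> s \<le> \<psi> m" if "0 \<le> s" "s \<le> b" for s
    using that by simp
  define K where "K = 2 * sqrt (\<psi> m)"
  have lip: "\<bar>\<psi>' s\<bar> \<le> K * \<psi> s" if s: "0 \<le> s" "s \<le> b" for s
  proof -
    have "\<psi> s powr (3/2) = \<psi> s * sqrt (\<psi> s)"
      using nonneg[OF s] powr_add[of "\<psi> s" 1 "1/2"] by (simp add: powr_half_sqrt)
    moreover have "\<psi> s * sqrt (\<psi> s) \<le> \<psi> s * sqrt (\<psi> m)"
      using nonneg[OF s] M[OF s] by (intro mult_left_mono) auto
    ultimately have "\<bar>\<psi>' s\<bar> \<le> 2 * (\<psi> s * sqrt (\<psi> m))" using bound[OF s] by simp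
    then show ?thesis by (simp add: K_def mult_ac)
  qed
  have "\<psi> 0 * exp (K * 0) \<le> \<psi> b * exp (K * b)"
  proof (rule DERIV_nonneg_imp_nondecreasing[OF b])
    fix s assume s: "0 \<le> s" "s \<le> b"
    have "((\<lambda>s. \<psi> s * exp (K * s)) has_real_derivative (\<psi>' s + K * \<psi> s) * exp (K * s)) (at s)"
      using deriv[OF s] by (auto intro!: derivative_eq_intros simp: algebra_simps)
    moreover have "0 \<le> (\<psi>' s + K * \<psi> s) * exp (K * s)"
      using lip[OF s] by (intro mult_nonneg_nonneg) auto
    ultimately show "\<exists>y. ((\<lambda>s. \<psi> s * exp (K * s)) has_real_derivative y) (at s) \<and> 0 \<le> y"
      by blast
  qed
  then have 1: "\<psi> 0 * exp (- K * b) \<le> \<psi> b"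
    by (simp add: exp_minus field_simps)
  have "\<psi> b * exp (- K * b) \<le> \<psi> 0 * exp (- K * 0)"
  proof (rule DERIV_nonpos_imp_nonincreasing[OF b])
    fix s assume s: "0 \<le> s" "s \<le> b"
    have "((\<lambda>s. \<psi> s * exp (- K * s)) has_real_derivative (\<psi>' s - K * \<psi> s) * exp (- K * s)) (at s)"
      using deriv[OF s] by (auto intro!: derivative_eq_intros simp: algebra_simps)
    moreover have "(\<psi>' s - K * \<psi> s) * exp (- K * s) \<le> 0"
      using lip[OF s] by (intro mult_nonpos_nonneg) auto
    ultimately show "\<exists>y. ((\<lambda>s. \<psi> s * exp (- K * s)) has_real_derivative y) (at s) \<and> y \<le> 0"
      by blast
  qed
  then have 2: "\<psi> b \<le> \<psi> 0 * exp (K * b)"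
    by (simp add: exp_minus field_simps)
  show thesis using that[OF 1 2] .
qed

text \<open>The differential inequality says that \<open>1 / sqrt \<psi>\<close> grows at rate at most one, so that
  \<open>1 / sqrt (\<psi> b) \<le> 1 / sqrt (\<psi> 0) + b\<close>; this is the bound solved for \<open>\<psi> b\<close>.\<close>

lemma self_concordant_curvature_lower_bound:
  fixes \<psi> \<psi>' :: "real \<Rightarrow> real"
  assumes b: "0 \<le> b"
    and deriv: "\<And>s. 0 \<le> s \<Longrightarrow> s \<le> b \<Longrightarrow> (\<psi> has_real_derivative \<psi>' s) (at s)"
    and nonneg: "\<And>s. 0 \<le> s \<Longrightarrow> s \<le> b \<Longrightarrow> 0 \<le> \<psi> s"
    and bound: "\<And>s. 0 \<le> s \<Longrightarrow> s \<le> b \<Longrightarrow> \<bar>\<psi>' s\<bar> \<le> 2 * \<psi> s powr (3/2)"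
  shows "\<psi> 0 / (1 + b * sqrt (\<psi> 0))\<^sup>2 \<le> \<psi> b"
proof (cases "\<psi> 0 = 0")
  case True
  then show ?thesis using nonneg[of b] b by simp
next
  case False
  then have pos0: "0 < \<psi> 0" using nonneg[of 0] b by simp
  have pos: "0 < \<psi> s" if s: "0 \<le> s" "s \<le> b" for s
  proof -
    obtain K where "\<psi> 0 * exp (- K * s) \<le> \<psi> s"
    proof (rule gronwall_nonneg[of s \<psi> \<psi>'])
      show "(\<psi> has_real_derivative \<psi>' q) (at q)" "0 \<le> \<psi> q" "\<bar>\<psi>' q\<bar> \<le> 2 * \<psi> q powr (3/2)"
        if "0 \<le> q" "q \<le> s" for q
        using that s deriv[of q] nonneg[of q] bound[of q] by linarith+
    qed (use s in blast)+
    moreover have "0 < \<psi> 0 * exp (- K * s)" using pos0 by simp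
    ultimately show ?thesis by linarith
  qed
  have "0 - inverse (sqrt (\<psi> 0)) \<le> b - inverse (sqrt (\<psi> b))"
  proof (rule DERIV_nonneg_imp_nondecreasing[OF b])
    fix s assume s: "0 \<le> s" "s \<le> b"
    note p = pos[OF s]
    have powr: "\<psi> s powr (3/2) = \<psi> s * sqrt (\<psi> s)"
      using p powr_add[of "\<psi> s" 1 "1/2"] by (simp add: powr_half_sqrt)
    have "((\<lambda>s. s - inverse (sqrt (\<psi> s))) has_real_derivative
            (1 + \<psi>' s / (2 * (\<psi> s * sqrt (\<psi> s))))) (at s)"
      using p by (auto intro!: derivative_eq_intros deriv[OF s] simp: field_simps power2_eq_square)
    moreover have "0 \<le> 1 + \<psi>' s / (2 * (\<psi> s * sqrt (\<psi> s)))"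
      using bound[OF s] p unfolding powr by (simp add: field_simps)
    ultimately show "\<exists>y. ((\<lambda>s. s - inverse (sqrt (\<psi> s))) has_real_derivative y) (at s) \<and> 0 \<le> y"
      by blast
  qed
  then have "1 / sqrt (\<psi> b) \<le> (1 + b * sqrt (\<psi> 0)) / sqrt (\<psi> 0)"
    using pos0 by (simp add: field_simps)
  then have "sqrt (\<psi> 0) \<le> sqrt (\<psi> b) * (1 + b * sqrt (\<psi> 0))"
    using pos0 pos[of b] b by (simp add: field_simps)
  then have "(sqrt (\<psi> 0))\<^sup>2 \<le> (sqrt (\<psi> b) * (1 + b * sqrt (\<psi> 0)))\<^sup>2"
    using pos0 by (intro power_mono) auto
  then have "\<psi> 0 \<le> \<psi> b * (1 + b * sqrt (\<psi> 0))\<^sup>2"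
    using pos0 pos[of b] b unfolding power_mult_distrib by simp
  moreover have "0 < 1 + b * sqrt (\<psi> 0)"
    using pos0 b by (intro add_pos_nonneg) auto
  ultimately show ?thesis
    by (simp only: pos_divide_le_eq zero_less_power)
qed

text \<open>Integrating the curvature bound twice: with \<open>r = sqrt (\<psi> 0)\<close>, the function
  \<open>r\<^sup>2 / (1 + r s)\<^sup>2\<close> has the antiderivative \<open>r - r / (1 + r s)\<close>, whose antiderivative is in turn
  \<open>r s - ln (1 + r s)\<close>, equal to \<open>omega r\<close> at \<open>s = 1\<close>.\<close>

lemma self_concordant_line_lower_bound:
  fixes f u \<psi> \<psi>' :: "real \<Rightarrow> real"
  assumes f: "\<And>s. 0 \<le> s \<Longrightarrow> s \<le> 1 \<Longrightarrow> (f has_real_derivative u s) (at s)"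
    and u: "\<And>s. 0 \<le> s \<Longrightarrow> s \<le> 1 \<Longrightarrow> (u has_real_derivative \<psi> s) (at s)"
    and \<psi>: "\<And>s. 0 \<le> s \<Longrightarrow> s \<le> 1 \<Longrightarrow> (\<psi> has_real_derivative \<psi>' s) (at s)"
    and nonneg: "\<And>s. 0 \<le> s \<Longrightarrow> s \<le> 1 \<Longrightarrow> 0 \<le> \<psi> s"
    and bound: "\<And>s. 0 \<le> s \<Longrightarrow> s \<le> 1 \<Longrightarrow> \<bar>\<psi>' s\<bar> \<le> 2 * \<psi> s powr (3/2)"
  shows "f 0 + u 0 + omega (sqrt (\<psi> 0)) \<le> f 1"
proof -
  define r where "r = sqrt (\<psi> 0)"
  have r: "0 \<le> r" and rr: "r\<^sup>2 = \<psi> 0" using nonneg[of 0] by (auto simp: r_def)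
  have pos: "0 < 1 + r * s" if "0 \<le> s" for s using r that by (simp add: add_pos_nonneg)
  have slope: "0 \<le> u s - u 0 - (r - r / (1 + r * s))" if s: "0 \<le> s" "s \<le> 1" for s
  proof -
    have "u 0 - u 0 - (r - r / (1 + r * 0)) \<le> u s - u 0 - (r - r / (1 + r * s))"
    proof (rule DERIV_nonneg_imp_nondecreasing[OF s(1)])
      fix q assume q: "0 \<le> q" "q \<le> s"
      have "((\<lambda>s. u s - u 0 - (r - r / (1 + r * s))) has_real_derivative
              \<psi> q - r\<^sup>2 / (1 + r * q)\<^sup>2) (at q)"
        using q s pos[OF q(1)]
        by (auto intro!: derivative_eq_intros u simp: power2_eq_square)
      moreover have "0 \<le> \<psi> q - r\<^sup>2 / (1 + r * q)\<^sup>2"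
        using self_concordant_curvature_lower_bound[of q \<psi> \<psi>'] q s \<psi> nonneg bound
        by (simp add: rr flip: r_def) (simp add: mult.commute)
      ultimately show "\<exists>y. ((\<lambda>s. u s - u 0 - (r - r / (1 + r * s))) has_real_derivative y) (at q)
          \<and> 0 \<le> y"
        by blast
    qed
    then show ?thesis by simp
  qed
  have "f 0 - u 0 * 0 - (r * 0 - ln (1 + r * 0)) \<le> f 1 - u 0 * 1 - (r * 1 - ln (1 + r * 1))"
  proof (rule DERIV_nonneg_imp_nondecreasing[of 0 1])
    fix s :: real assume s: "0 \<le> s" "s \<le> 1"
    have "((\<lambda>s. f s - u 0 * s - (r * s - ln (1 + r * s))) has_real_derivative
            u s - u 0 - (r - r / (1 + r * s))) (at s)"
      using pos[OF s(1)] by (auto intro!: derivative_eq_intros f[OF s])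
    with slope[OF s]
    show "\<exists>y. ((\<lambda>s. f s - u 0 * s - (r * s - ln (1 + r * s))) has_real_derivative y) (at s) \<and> 0 \<le> y"
      by blast
  qed simp
  then show ?thesis by (simp add: omega_def r_def)
qed

text \<open>If the slope \<open>u\<close> starts positive it stays positive, and the inequality \<open>u\<^sup>2 \<le> \<nu> u'\<close> says that
  \<open>- 1 / u\<close> grows at rate at least \<open>1 / \<nu>\<close>. A slope larger than \<open>\<nu>\<close> at \<open>0\<close> would therefore blow
  up before time one.\<close>

lemma barrier_line_slope_le:
  fixes u \<psi> :: "real \<Rightarrow> real"
  assumes \<nu>: "0 \<le> \<nu>"
    and u: "\<And>s. 0 \<le> s \<Longrightarrow> s \<le> 1 \<Longrightarrow> (u has_real_derivative \<psi> s) (at s)"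
    and nonneg: "\<And>s. 0 \<le> s \<Longrightarrow> s \<le> 1 \<Longrightarrow> 0 \<le> \<psi> s"
    and barrier: "\<And>s. 0 \<le> s \<Longrightarrow> s \<le> 1 \<Longrightarrow> (u s)\<^sup>2 \<le> \<nu> * \<psi> s"
  shows "u 0 \<le> \<nu>"
proof (cases "u 0 \<le> 0")
  case True
  then show ?thesis using \<nu> by simp
next
  case False
  then have "0 < (u 0)\<^sup>2" by simp
  then have \<nu>pos: "0 < \<nu>" using barrier[of 0] \<nu> by (cases "\<nu> = 0") auto
  have pos: "0 < u s" if s: "0 \<le> s" "s \<le> 1" for s
  proof -
    have "u 0 \<le> u s"
      using s by (intro DERIV_nonneg_imp_nondecreasing[of 0 s u]) (use u nonneg in force)+
    then show ?thesis using False by simp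
  qed
  have "- inverse (u 0) - 0 / \<nu> \<le> - inverse (u 1) - 1 / \<nu>"
  proof (rule DERIV_nonneg_imp_nondecreasing[of 0 1])
    fix s :: real assume s: "0 \<le> s" "s \<le> 1"
    have "((\<lambda>s. - inverse (u s) - s / \<nu>) has_real_derivative \<psi> s / (u s)\<^sup>2 - 1 / \<nu>) (at s)"
      using pos[OF s] \<nu>pos
      by (auto intro!: derivative_eq_intros u[OF s] simp: power2_eq_square field_simps)
    moreover have "0 \<le> \<psi> s / (u s)\<^sup>2 - 1 / \<nu>"
      using barrier[OF s] pos[OF s] \<nu>pos by (simp add: field_simps)
    ultimately show "\<exists>y. ((\<lambda>s. - inverse (u s) - s / \<nu>) has_real_derivative y) (at s) \<and> 0 \<le> y"
      by blast
  qed simp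
  moreover have "0 < inverse (u 1)" using pos[of 1] by simp
  ultimately have "inverse \<nu> < inverse (u 0)" by (simp only: divide_inverse)
  then show ?thesis using pos[of 0] \<nu>pos by (simp add: less_imp_le)
qed

lemma omega_nonneg:
  assumes "0 \<le> r"
  shows "0 \<le> omega r"
  using ln_add_one_self_le_self[OF assms] by (simp add: omega_def)

text \<open>Applied to \<open>(1 + r) (1 - l)\<close>, the inequality \<open>ln x \<le> x - 1\<close> shows half of the statement that
  \<open>omega_star\<close> is the convex conjugate of \<open>omega\<close>.\<close>

lemma omega_fenchel_young:
  assumes r: "0 \<le> r" and l: "l < 1"
  shows "l * r \<le> omega r + omega_star l"
proof -
  have "ln (1 + r) + ln (1 - l) = ln ((1 + r) * (1 - l))"
    using assms by (simp add: ln_mult)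
  also have "\<dots> \<le> (1 + r) * (1 - l) - 1"
    using assms by (intro ln_le_minus_one) simp
  finally show ?thesis by (simp add: omega_def omega_star_def algebra_simps)
qed

section \<open>Symmetric second derivatives and quadratic forms\<close>

lemma has_real_derivative_along_line:
  assumes "GDERIV F (x + s *\<^sub>R h) :> D"
  shows "((\<lambda>s. F (x + s *\<^sub>R h)) has_real_derivative D \<bullet> h) (at s)"
proof -
  have "((\<lambda>s. x + s *\<^sub>R h) has_derivative (\<lambda>d. d *\<^sub>R h)) (at s)"
    by (auto intro!: derivative_eq_intros)
  from has_derivative_compose[OF this, of F "\<lambda>k. k \<bullet> D"] assms
  show ?thesis
    by (simp add: gderiv_def has_field_derivative_def inner_commute mult_commute_abs)
qed

text \<open>The mean value theorem in the direction \<open>u\<close>, applied to the difference of \<open>F\<close> on two parallel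
  segments, turns the second difference into a difference of gradients, which the derivative of the
  gradient at \<open>x\<close> approximates. The estimate is not symmetric in \<open>u\<close> and \<open>v\<close>, but the second
  difference is.\<close>

lemma second_difference_bound:
  fixes F :: "'a::real_inner \<Rightarrow> real"
  assumes S: "open S" "x \<in> S"
    and F: "\<And>z. z \<in> S \<Longrightarrow> GDERIV F z :> G z"
    and G: "(G has_derivative H) (at x)"
    and e: "0 < e"
  obtains d where "0 < d" "\<And>s. 0 < s \<Longrightarrow> s < d \<Longrightarrow>
     \<bar>F (x + s *\<^sub>R u + s *\<^sub>R v) - F (x + s *\<^sub>R u) - F (x + s *\<^sub>R v) + F x - s\<^sup>2 * (H v \<bullet> u)\<bar>
       \<le> s\<^sup>2 * (2 * e * (norm u + norm v) * norm u)"
proof -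
  obtain d1 where d1: "0 < d1" "ball x d1 \<subseteq> S"
    using S open_contains_ball by blast
  from G e obtain d2 where d2: "0 < d2"
    and lin: "\<And>z. norm (z - x) < d2 \<Longrightarrow> norm (G z - G x - H (z - x)) \<le> e * norm (z - x)"
    unfolding has_derivative_at_alt by blast
  have H: "bounded_linear H" using G has_derivative_bounded_linear by blast
  define N where "N = norm u + norm v"
  have N: "0 \<le> N" by (simp add: N_def)
  define d where "d = min d1 d2 / (N + 1)"
  have "0 < d" using d1 d2 N by (simp add: d_def)
  moreover have "\<bar>F (x + s *\<^sub>R u + s *\<^sub>R v) - F (x + s *\<^sub>R u) - F (x + s *\<^sub>R v) + F x - s\<^sup>2 * (H v \<bullet> u)\<bar>
       \<le> s\<^sup>2 * (2 * e * N * norm u)" if s: "0 < s" "s < d" for s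
  proof -
    have "s * (N + 1) < min d1 d2" using s N by (simp add: d_def field_simps)
    then have sN: "s * N < min d1 d2" using s by (simp add: algebra_simps)
    have small: "norm (p *\<^sub>R u + q *\<^sub>R v) \<le> s * N" if "0 \<le> p" "p \<le> s" "0 \<le> q" "q \<le> s" for p q
    proof -
      have "norm (p *\<^sub>R u + q *\<^sub>R v) \<le> p * norm u + q * norm v"
        using that norm_triangle_ineq[of "p *\<^sub>R u" "q *\<^sub>R v"] by simp
      also have "\<dots> \<le> s * norm u + s * norm v"
        using that by (intro add_mono mult_right_mono) auto
      finally show ?thesis by (simp add: N_def distrib_left)
    qed
    have mem: "x + (p *\<^sub>R u + q *\<^sub>R v) \<in> S" if "0 \<le> p" "p \<le> s" "0 \<le> q" "q \<le> s" for p q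
    proof -
      have "dist (x + (p *\<^sub>R u + q *\<^sub>R v)) x < d1"
        using small[OF that] sN by (simp add: dist_norm)
      then show ?thesis using d1(2) by (auto simp: dist_commute)
    qed
    have err: "norm (G (x + (p *\<^sub>R u + q *\<^sub>R v)) - G x - H (p *\<^sub>R u + q *\<^sub>R v)) \<le> e * (s * N)"
      if "0 \<le> p" "p \<le> s" "0 \<le> q" "q \<le> s" for p q
    proof -
      have "norm (G (x + (p *\<^sub>R u + q *\<^sub>R v)) - G x - H (p *\<^sub>R u + q *\<^sub>R v)) \<le> e * norm (p *\<^sub>R u + q *\<^sub>R v)"
        using lin[of "x + (p *\<^sub>R u + q *\<^sub>R v)"] small[OF that] sN by simp
      also have "\<dots> \<le> e * (s * N)" using small[OF that] e by simp
      finally show ?thesis .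
    qed
    define \<phi> where "\<phi> p = F ((x + s *\<^sub>R v) + p *\<^sub>R u) - F (x + p *\<^sub>R u)" for p
    have "\<exists>p. 0 < p \<and> p < s \<and> \<phi> s - \<phi> 0 = (s - 0) *
            ((G ((x + s *\<^sub>R v) + p *\<^sub>R u) - G (x + p *\<^sub>R u)) \<bullet> u)"
    proof (rule MVT2[OF s(1)])
      fix p assume p: "0 \<le> p" "p \<le> s"
      show "(\<phi> has_real_derivative (G ((x + s *\<^sub>R v) + p *\<^sub>R u) - G (x + p *\<^sub>R u)) \<bullet> u) (at p)"
        unfolding \<phi>_def inner_diff_left
        using p s mem[of p s] mem[of p 0]
        by (intro DERIV_diff has_real_derivative_along_line F) (auto simp: algebra_simps)
    qed
    then obtain p where p: "0 < p" "p < s"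
      and mv: "\<phi> s - \<phi> 0 = s * ((G (x + (p *\<^sub>R u + s *\<^sub>R v)) - G (x + (p *\<^sub>R u + 0 *\<^sub>R v))) \<bullet> u)"
      by (auto simp: algebra_simps)
    define r where "r q = G (x + (p *\<^sub>R u + q *\<^sub>R v)) - G x - H (p *\<^sub>R u + q *\<^sub>R v)" for q
    have split: "G (x + (p *\<^sub>R u + s *\<^sub>R v)) - G (x + (p *\<^sub>R u + 0 *\<^sub>R v)) = s *\<^sub>R H v + (r s - r 0)"
      using H by (simp add: r_def linear_add linear_scale bounded_linear.linear)
    have "norm (r s - r 0) \<le> 2 * (e * (s * N))"
      using norm_triangle_ineq4[of "r s" "r 0"] err[of p s] err[of p 0] p s
      unfolding r_def by linarith
    then have "\<bar>(r s - r 0) \<bullet> u\<bar> \<le> 2 * (e * (s * N)) * norm u"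
      by (intro order_trans[OF Cauchy_Schwarz_ineq2] mult_right_mono) auto
    then have "s * \<bar>(r s - r 0) \<bullet> u\<bar> \<le> s * (2 * (e * (s * N)) * norm u)"
      using s by simp
    moreover have "\<phi> s - \<phi> 0 - s\<^sup>2 * (H v \<bullet> u) = s * ((r s - r 0) \<bullet> u)"
      unfolding mv split by (simp add: algebra_simps power2_eq_square)
    ultimately have "\<bar>\<phi> s - \<phi> 0 - s\<^sup>2 * (H v \<bullet> u)\<bar> \<le> s * (2 * (e * (s * N)) * norm u)"
      using s by (simp only: abs_mult)
    also have "\<dots> = s\<^sup>2 * (2 * e * N * norm u)"
      by (simp add: power2_eq_square)
    finally have "\<bar>\<phi> s - \<phi> 0 - s\<^sup>2 * (H v \<bullet> u)\<bar> \<le> s\<^sup>2 * (2 * e * N * norm u)" .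
    moreover have "\<phi> s - \<phi> 0 = F (x + s *\<^sub>R u + s *\<^sub>R v) - F (x + s *\<^sub>R u) - F (x + s *\<^sub>R v) + F x"
      by (simp add: \<phi>_def algebra_simps)
    ultimately show ?thesis by simp
  qed
  ultimately show thesis using that unfolding N_def by blast
qed

text \<open>The second difference of \<open>F\<close> in the directions \<open>u\<close> and \<open>v\<close>, divided by \<open>s\<^sup>2\<close>, is approximated
  by \<open>H v \<bullet> u\<close> and, after exchanging the directions, by \<open>H u \<bullet> v\<close>.\<close>

lemma gradient_derivative_symmetric:
  fixes F :: "'a::real_inner \<Rightarrow> real"
  assumes S: "open S" "x \<in> S"
    and F: "\<And>z. z \<in> S \<Longrightarrow> GDERIV F z :> G z"
    and G: "(G has_derivative H) (at x)"
  shows "H u \<bullet> v = u \<bullet> H v"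
proof -
  define c where "c = 2 * (norm u + norm v) * (norm u + norm v)"
  have c: "0 \<le> c" by (simp add: c_def)
  have "\<bar>H v \<bullet> u - H u \<bullet> v\<bar> \<le> 0 + e" if "0 < e" for e
  proof -
    define e' where "e' = e / (c + 1)"
    have e': "0 < e'" using that c by (simp add: e'_def)
    obtain d1 where d1: "0 < d1" "\<And>s. 0 < s \<Longrightarrow> s < d1 \<Longrightarrow>
     \<bar>F (x + s *\<^sub>R u + s *\<^sub>R v) - F (x + s *\<^sub>R u) - F (x + s *\<^sub>R v) + F x - s\<^sup>2 * (H v \<bullet> u)\<bar>
       \<le> s\<^sup>2 * (2 * e' * (norm u + norm v) * norm u)"
      using second_difference_bound[OF S F G e', of u v] by blast
    obtain d2 where d2: "0 < d2" "\<And>s. 0 < s \<Longrightarrow> s < d2 \<Longrightarrow>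
     \<bar>F (x + s *\<^sub>R v + s *\<^sub>R u) - F (x + s *\<^sub>R v) - F (x + s *\<^sub>R u) + F x - s\<^sup>2 * (H u \<bullet> v)\<bar>
       \<le> s\<^sup>2 * (2 * e' * (norm v + norm u) * norm v)"
      using second_difference_bound[OF S F G e', of v u] by blast
    define s where "s = min d1 d2 / 2"
    have s: "0 < s" "s < d1" "s < d2" using d1(1) d2(1) by (auto simp: s_def min_def)
    let ?D = "F (x + s *\<^sub>R u + s *\<^sub>R v) - F (x + s *\<^sub>R u) - F (x + s *\<^sub>R v) + F x"
    have D2: "F (x + s *\<^sub>R v + s *\<^sub>R u) - F (x + s *\<^sub>R v) - F (x + s *\<^sub>R u) + F x = ?D"
      by (simp add: algebra_simps)
    have "\<bar>s\<^sup>2 * (H v \<bullet> u) - s\<^sup>2 * (H u \<bullet> v)\<bar>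
        \<le> s\<^sup>2 * (2 * e' * (norm u + norm v) * norm u) + s\<^sup>2 * (2 * e' * (norm v + norm u) * norm v)"
      using d1(2)[OF s(1,2)] d2(2)[OF s(1,3)] unfolding D2 by linarith
    then have "s\<^sup>2 * \<bar>H v \<bullet> u - H u \<bullet> v\<bar> \<le> s\<^sup>2 * (e' * c)"
      unfolding right_diff_distrib[symmetric] abs_mult c_def by (simp add: algebra_simps)
    then have "\<bar>H v \<bullet> u - H u \<bullet> v\<bar> \<le> e' * c" using s(1) by simp
    also have "\<dots> \<le> e" using c that by (simp add: e'_def field_simps)
    finally show ?thesis by simp
  qed
  then have "\<bar>H v \<bullet> u - H u \<bullet> v\<bar> \<le> 0" by (rule field_le_epsilon)
  then show ?thesis by (simp add: inner_commute)
qed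


text \<open>The quadratic polynomial \<open>q \<mapsto> (u + q v) \<bullet> M (u + q v)\<close> is nonnegative, so its discriminant is
  not positive. If the leading coefficient is zero, the polynomial is affine in \<open>q\<close> and hence constant.\<close>

lemma nonneg_form_Cauchy_Schwarz:
  fixes M :: "real^'n^'n"
  assumes sym: "\<And>u v. u \<bullet> (M *v v) = v \<bullet> (M *v u)"
    and nonneg: "\<And>u. 0 \<le> u \<bullet> (M *v u)"
  shows "(u \<bullet> (M *v v))\<^sup>2 \<le> (u \<bullet> (M *v u)) * (v \<bullet> (M *v v))"
proof -
  let ?a = "u \<bullet> (M *v u)" and ?b = "u \<bullet> (M *v v)" and ?c = "v \<bullet> (M *v v)"
  have form: "0 \<le> ?a + 2 * q * ?b + q\<^sup>2 * ?c" for q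
  proof -
    have "(u + q *\<^sub>R v) \<bullet> (M *v (u + q *\<^sub>R v)) = ?a + 2 * q * ?b + q\<^sup>2 * ?c"
      using sym[of v u]
      by (simp add: matrix_vector_right_distrib matrix_vector_mult_scaleR inner_add_left inner_add_right
          power2_eq_square algebra_simps)
    then show ?thesis using nonneg[of "u + q *\<^sub>R v"] by simp
  qed
  show ?thesis
  proof (cases "?c = 0")
    case True
    have "?b = 0"
    proof (rule ccontr)
      assume "?b \<noteq> 0"
      \<comment> \<open>The affine function \<open>?a + 2 q ?b\<close> takes the value \<open>-1\<close> at this \<open>q\<close>.\<close>
      then have "2 * (- (?a + 1) / (2 * ?b)) * ?b = - (?a + 1)" by simp
      with form[of "- (?a + 1) / (2 * ?b)"] show False unfolding True by simp
    qed
    then show ?thesis using True by simp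
  next
    case False
    then have c: "0 < ?c" using nonneg[of v] by simp
    \<comment> \<open>The polynomial is minimal at \<open>q = - ?b / ?c\<close>.\<close>
    have "0 \<le> ?c * (?a + 2 * (- ?b / ?c) * ?b + (- ?b / ?c)\<^sup>2 * ?c)"
      using form[of "- ?b / ?c"] c by (intro mult_nonneg_nonneg) auto
    also have "\<dots> = ?c * ?a - ?b\<^sup>2"
      using c by (simp add: power2_eq_square field_simps)
    finally show ?thesis by (simp add: mult.commute)
  qed
qed

section \<open>Attained maxima\<close>

lemma upper_semicontinuous_on_add_continuous:
  fixes f k :: "'a::topological_space \<Rightarrow> real"
  assumes f: "upper_semicontinuous_on S f" and k: "continuous_on S k"
  shows "upper_semicontinuous_on S (\<lambda>x. f x + k x)"
  unfolding upper_semicontinuous_on_def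
proof (intro ballI allI impI)
  fix x and e :: real assume x: "x \<in> S" and e: "0 < e"
  have "\<forall>\<^sub>F z in at x within S. f z < f x + e/2"
    using f x e unfolding upper_semicontinuous_on_def by auto
  moreover have "\<forall>\<^sub>F z in at x within S. k z < k x + e/2"
    using k x e unfolding continuous_on_def by (intro order_tendstoD(2)[of k "k x"]) auto
  ultimately show "\<forall>\<^sub>F z in at x within S. f z + k z < f x + k x + e"
    by eventually_elim simp
qed

lemma upper_semicontinuous_on_subset:
  assumes "upper_semicontinuous_on S f" "T \<subseteq> S"
  shows "upper_semicontinuous_on T f"
  using assms unfolding upper_semicontinuous_on_def
  by (auto intro!: filter_leD[OF at_le[OF assms(2)]])

text \<open>If no point were a maximizer, every \<open>x\<close> would have a better point \<open>w x\<close> and, by semicontinuity, a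
  neighbourhood on which \<open>f\<close> stays below \<open>f (w x)\<close>. Finitely many of these neighbourhoods cover \<open>S\<close>,
  and the best of the corresponding points \<open>w x\<close> lies in one of them, a contradiction.\<close>

lemma upper_semicontinuous_attains_sup:
  assumes S: "compact S" "S \<noteq> {}" and f: "upper_semicontinuous_on S f"
  shows "\<exists>x\<in>S. \<forall>z\<in>S. f z \<le> f x"
proof (rule ccontr)
  assume "\<not> ?thesis"
  then obtain w where w: "\<And>x. x \<in> S \<Longrightarrow> w x \<in> S \<and> f x < f (w x)"
    by (metis linorder_not_le)
  have "\<forall>x\<in>S. \<exists>U. open U \<and> x \<in> U \<and> (\<forall>z\<in>U \<inter> S. f z < f (w x))"
  proof
    fix x assume x: "x \<in> S"
    have "\<forall>\<^sub>F z in at x within S. f z < f x + (f (w x) - f x)"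
      using f x w[OF x] unfolding upper_semicontinuous_on_def by (metis diff_gt_0_iff_gt)
    then obtain U where "open U" "x \<in> U" "\<And>z. z \<in> U \<Longrightarrow> z \<noteq> x \<Longrightarrow> z \<in> S \<Longrightarrow> f z < f (w x)"
      unfolding eventually_at_topological by auto
    then show "\<exists>U. open U \<and> x \<in> U \<and> (\<forall>z\<in>U \<inter> S. f z < f (w x))"
      using w[OF x] by (metis IntE)
  qed
  then obtain U where U: "\<forall>x\<in>S. open (U x) \<and> x \<in> U x \<and> (\<forall>z\<in>U x \<inter> S. f z < f (w x))"
    by (rule bchoice[THEN exE])
  then have "\<And>x. x \<in> S \<Longrightarrow> open (U x)" "S \<subseteq> (\<Union>x\<in>S. U x)" by auto
  from compactE_image[OF S(1) this]
  obtain C where C: "C \<subseteq> S" "finite C" "S \<subseteq> (\<Union>c\<in>C. U c)" by metis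
  then have "C \<noteq> {}" using S(2) by auto
  define m where "m = Max (f ` w ` C)"
  have "m \<in> f ` w ` C" unfolding m_def using C \<open>C \<noteq> {}\<close> by (intro Max_in) auto
  then obtain c where c: "c \<in> C" "m = f (w c)" by auto
  then obtain c' where c': "c' \<in> C" "w c \<in> U c'" using C w by blast
  then have "m < f (w c')" using bspec[OF U, of c'] c w[of c] C(1) by auto
  moreover have "f (w c') \<le> m" unfolding m_def using c' C by (intro Max_ge) auto
  ultimately show False by simp
qed

lemma max_over_eqI:
  assumes "x \<in> S" "\<And>z. z \<in> S \<Longrightarrow> f z \<le> f x"
  shows "max_over S f = f x"
  unfolding max_over_def using assms by (intro Greatest_equality) auto

lemma arg_max_on_attained:
  fixes f :: "'a \<Rightarrow> 'b::linorder"
  assumes "\<exists>x\<in>S. \<forall>z\<in>S. f z \<le> f x"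
  shows "arg_max_on f S \<in> S" "z \<in> S \<Longrightarrow> f z \<le> f (arg_max_on f S)"
proof -
  have "\<exists>x. is_arg_max f (\<lambda>x. x \<in> S) x"
    using assms by (auto simp: is_arg_max_def not_less)
  then have "is_arg_max f (\<lambda>x. x \<in> S) (arg_max_on f S)"
    unfolding arg_max_on_def arg_max_def by (rule someI_ex)
  then show "arg_max_on f S \<in> S" "z \<in> S \<Longrightarrow> f z \<le> f (arg_max_on f S)"
    by (auto simp: is_arg_max_def not_less)
qed

lemma arg_min_on_attained:
  fixes f :: "'a \<Rightarrow> 'b::linorder"
  assumes "\<exists>x\<in>S. \<forall>z\<in>S. f x \<le> f z"
  shows "arg_min_on f S \<in> S" "z \<in> S \<Longrightarrow> f (arg_min_on f S) \<le> f z"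
proof -
  have "\<exists>x. is_arg_min f (\<lambda>x. x \<in> S) x"
    using assms by (auto simp: is_arg_min_def not_less)
  then have "is_arg_min f (\<lambda>x. x \<in> S) (arg_min_on f S)"
    unfolding arg_min_on_def arg_min_def by (rule someI_ex)
  then show "arg_min_on f S \<in> S" "z \<in> S \<Longrightarrow> f (arg_min_on f S) \<le> f z"
    by (auto simp: is_arg_min_def not_less)
qed

section \<open>Self-concordant barriers of convex bodies\<close>

locale barrier_body =
  fixes X :: "(real^'n) set" and F :: "real^'n \<Rightarrow> real" and \<nu> :: real
  assumes bounded: "bounded X" and closed: "closed X" and convex: "convex X"
    and interior_nonempty: "interior X \<noteq> {}"
    and barrier: "self_concordant_barrier X \<nu> F"
begin

lemma compact: "compact X"
  using bounded closed by (simp add: compact_eq_bounded_closed)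

lemma GDERIV_grad:
  assumes "x \<in> interior X"
  shows "GDERIV F x :> grad F x"
proof -
  have "F differentiable (at x)"
    using assms barrier
    by (auto simp: self_concordant_barrier_def self_concordant_on_def C3_on_def)
  then obtain f' where f': "(F has_derivative f') (at x)" unfolding differentiable_def by blast
  then have "linear f'" by (rule has_derivative_linear)
  then have "f' = (\<lambda>h. h \<bullet> adjoint f' 1)"
    by (metis adjoint_works inner_real_def mult.right_neutral)
  with f' have D: "GDERIV F x :> adjoint f' 1" by (simp add: gderiv_def)
  show ?thesis
    unfolding grad_def
  proof (rule theI[where P = "\<lambda>D. GDERIV F x :> D", OF D])
    fix E assume "GDERIV F x :> E"
    then have "(\<lambda>h. h \<bullet> E) = (\<lambda>h. h \<bullet> adjoint f' 1)"
      using D unfolding gderiv_def by (rule has_derivative_unique)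
    then show "E = adjoint f' 1" by (metis inner_commute vector_eq_ldot)
  qed
qed

lemma grad_has_derivative:
  assumes "x \<in> interior X"
  shows "(grad F has_derivative (\<lambda>h. hessian F x *v h)) (at x)"
proof -
  have "grad F differentiable (at x)"
    using assms barrier
    by (auto simp: self_concordant_barrier_def self_concordant_on_def C3_on_def)
  then have D: "(grad F has_derivative frechet_derivative (grad F) (at x)) (at x)"
    using frechet_derivative_works by blast
  then show ?thesis
    by (simp add: hessian_def matrix_vector_mul has_derivative_bounded_linear)
qed

lemma hessian_has_derivative:
  assumes "x \<in> interior X"
  shows "(hessian F has_derivative frechet_derivative (hessian F) (at x)) (at x)"
  using assms barrier frechet_derivative_works
  by (auto simp: self_concordant_barrier_def self_concordant_on_def C3_on_def)

text \<open>Restricted to a line, the gradient, Hessian and third derivative of the definitions become the first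
  three derivatives of a real function, to which the estimates on an interval apply.\<close>

lemma line_derivatives:
  assumes "x + s *\<^sub>R h \<in> interior X"
  shows line_deriv: "((\<lambda>s. F (x + s *\<^sub>R h)) has_real_derivative grad F (x + s *\<^sub>R h) \<bullet> h) (at s)"
    and line_deriv2: "((\<lambda>s. grad F (x + s *\<^sub>R h) \<bullet> h) has_real_derivative
          h \<bullet> (hessian F (x + s *\<^sub>R h) *v h)) (at s)"
    and line_deriv3: "((\<lambda>s. h \<bullet> (hessian F (x + s *\<^sub>R h) *v h)) has_real_derivative
          third_deriv F (x + s *\<^sub>R h) h h h) (at s)"
proof -
  show "((\<lambda>s. F (x + s *\<^sub>R h)) has_real_derivative grad F (x + s *\<^sub>R h) \<bullet> h) (at s)"
    by (intro has_real_derivative_along_line GDERIV_grad assms)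
  have line: "((\<lambda>s. x + s *\<^sub>R h) has_derivative (\<lambda>d. d *\<^sub>R h)) (at s)"
    by (auto intro!: derivative_eq_intros)
  have "((\<lambda>s. grad F (x + s *\<^sub>R h)) has_derivative (\<lambda>d. hessian F (x + s *\<^sub>R h) *v (d *\<^sub>R h))) (at s)"
    using has_derivative_compose[OF line grad_has_derivative[OF assms]] .
  from has_derivative_inner_left[OF this, of h]
  show "((\<lambda>s. grad F (x + s *\<^sub>R h) \<bullet> h) has_real_derivative
          h \<bullet> (hessian F (x + s *\<^sub>R h) *v h)) (at s)"
    by (simp add: has_field_derivative_def matrix_vector_mult_scaleR inner_commute mult_commute_abs)
  have "linear (\<lambda>M::real^'n^'n. h \<bullet> (M *v h))"
    by (intro linearI) (simp_all add: matrix_vector_mult_add_rdistrib inner_add_right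
        scaleR_matrix_vector_assoc[symmetric])
  then have bl: "bounded_linear (\<lambda>M::real^'n^'n. h \<bullet> (M *v h))"
    by (simp add: linear_conv_bounded_linear)
  let ?D = "frechet_derivative (hessian F) (at (x + s *\<^sub>R h))"
  have D: "((\<lambda>s. hessian F (x + s *\<^sub>R h)) has_derivative (\<lambda>d. ?D (d *\<^sub>R h))) (at s)"
    using has_derivative_compose[OF line hessian_has_derivative[OF assms]] .
  have "linear ?D" using hessian_has_derivative[OF assms] by (rule has_derivative_linear)
  then have "(\<lambda>d. h \<bullet> (?D (d *\<^sub>R h) *v h)) = (*) (third_deriv F (x + s *\<^sub>R h) h h h)"
    by (simp add: fun_eq_iff third_deriv_def linear_scale scaleR_matrix_vector_assoc[symmetric])
  with bounded_linear.has_derivative[OF bl D]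
  show "((\<lambda>s. h \<bullet> (hessian F (x + s *\<^sub>R h) *v h)) has_real_derivative
          third_deriv F (x + s *\<^sub>R h) h h h) (at s)"
    by (simp add: has_field_derivative_def)
qed

lemma hessian_symmetric:
  assumes "x \<in> interior X"
  shows "u \<bullet> (hessian F x *v v) = v \<bullet> (hessian F x *v u)"
  using gradient_derivative_symmetric[OF open_interior assms GDERIV_grad grad_has_derivative[OF assms]]
  by (metis inner_commute)

lemma line_preimage_convex: "convex {s. x + s *\<^sub>R h \<in> interior X}"
proof (rule convexI)
  fix a b p q :: real
  assume "a \<in> {s. x + s *\<^sub>R h \<in> interior X}" "b \<in> {s. x + s *\<^sub>R h \<in> interior X}"
    and pq: "0 \<le> p" "0 \<le> q" "p + q = 1"
  then have "p *\<^sub>R (x + a *\<^sub>R h) + q *\<^sub>R (x + b *\<^sub>R h) \<in> interior X"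
    using convex_interior[OF convex] by (auto intro: convexD)
  moreover have "p *\<^sub>R (x + a *\<^sub>R h) + q *\<^sub>R (x + b *\<^sub>R h) = (p + q) *\<^sub>R x + (p *\<^sub>R a + q *\<^sub>R b) *\<^sub>R h"
    by (simp add: algebra_simps)
  ultimately show "p *\<^sub>R a + q *\<^sub>R b \<in> {s. x + s *\<^sub>R h \<in> interior X}" using pq by simp
qed

text \<open>On a line \<open>F\<close> is a convex function that lies above its tangents, so its slope is monotone and has a
  nonnegative derivative.\<close>

lemma hessian_nonneg:
  assumes x: "x \<in> interior X"
  shows "0 \<le> h \<bullet> (hessian F x *v h)"
proof -
  define A where "A = {s. x + s *\<^sub>R h \<in> interior X}"
  define f where "f s = F (x + s *\<^sub>R h)" for s
  define u where "u s = grad F (x + s *\<^sub>R h) \<bullet> h" for s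
  have "open A"
    unfolding A_def
    using open_vimage[OF open_interior, of "\<lambda>s. x + s *\<^sub>R h" X]
    by (simp add: vimage_def continuous_intros)
  have A: "convex A" unfolding A_def by (rule line_preimage_convex)
  have F: "convex_on (interior X) F"
    using barrier by (simp add: self_concordant_barrier_def self_concordant_on_def)
  have f: "convex_on A f"
  proof (rule convex_onI[OF _ A])
    fix q a b :: real assume q: "0 < q" "q < 1" and ab: "a \<in> A" "b \<in> A"
    have "f ((1 - q) *\<^sub>R a + q *\<^sub>R b) = F ((1 - q) *\<^sub>R (x + a *\<^sub>R h) + q *\<^sub>R (x + b *\<^sub>R h))"
      by (simp add: f_def algebra_simps)
    also have "\<dots> \<le> (1 - q) * f a + q * f b"
      using convex_onD[OF F, of q] q ab by (simp add: A_def f_def)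
    finally show "f ((1 - q) *\<^sub>R a + q *\<^sub>R b) \<le> (1 - q) * f a + q * f b" .
  qed
  have tangent: "u a * (b - a) \<le> f b - f a" if "a \<in> A" "b \<in> A" for a b
  proof (rule convex_on_imp_above_tangent[OF f convex_connected[OF A]])
    show "(f has_real_derivative u a) (at a within A)"
      using that(1) unfolding f_def u_def A_def
      by (intro line_deriv[THEN has_field_derivative_at_within]) simp
  qed (use that \<open>open A\<close> in \<open>auto simp: interior_open\<close>)
  have "mono_on A u"
  proof (rule mono_onI)
    fix a b assume ab: "a \<in> A" "b \<in> A" "a \<le> b"
    have "u a * (b - a) + u b * (a - b) \<le> 0"
      using tangent[OF ab(1,2)] tangent[OF ab(2,1)] by simp
    then have "0 \<le> (u b - u a) * (b - a)" by (simp add: algebra_simps)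
    then show "u a \<le> u b" using ab(3) by (cases "a = b") (auto simp: zero_le_mult_iff)
  qed
  moreover have "(u has_real_derivative h \<bullet> (hessian F x *v h)) (at 0)"
    using line_deriv2[of x 0 h] x by (simp add: u_def[abs_def])
  moreover have "0 \<in> interior A" using \<open>open A\<close> x by (simp add: interior_open A_def)
  ultimately show ?thesis by (rule mono_on_imp_deriv_nonneg)
qed

lemma third_deriv_bound:
  assumes "x \<in> interior X"
  shows "\<bar>third_deriv F x h h h\<bar> \<le> 2 * (h \<bullet> (hessian F x *v h)) powr (3/2)"
  using assms barrier by (auto simp: self_concordant_barrier_def self_concordant_on_def)

lemma barrier_parameter_bound:
  assumes "x \<in> interior X"
  shows "(grad F x \<bullet> h)\<^sup>2 \<le> \<nu> * (h \<bullet> (hessian F x *v h))"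
  using assms barrier by (auto simp: self_concordant_barrier_def)

lemma segment_in_interior:
  assumes "x \<in> interior X" "z \<in> X" "0 \<le> s" "s < 1"
  shows "x + s *\<^sub>R (z - x) \<in> interior X"
proof -
  have "z - (1 - s) *\<^sub>R (z - x) \<in> interior X"
    using assms closure_subset
    by (intro mem_interior_closure_convex_shrink[OF convex]) auto
  then show ?thesis by (simp add: algebra_simps)
qed

text \<open>A direction of zero curvature at \<open>x\<close> has zero curvature along the whole ray inside the body, so
  \<open>F\<close> grows at most linearly on it. As the body is bounded, the ray meets the boundary after a
  finite time \<open>T\<close>, and there \<open>F\<close> would have to tend to infinity.\<close>

lemma hessian_positive_definite:
  assumes x: "x \<in> interior X" and h: "h \<noteq> 0"
  shows "0 < h \<bullet> (hessian F x *v h)"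
proof (rule ccontr)
  assume "\<not> ?thesis"
  then have zero: "h \<bullet> (hessian F x *v h) = 0" using hessian_nonneg[OF x, of h] by simp
  obtain T where T: "0 < T" and front: "x + T *\<^sub>R h \<in> frontier X"
    and int: "\<And>s. 0 \<le> s \<Longrightarrow> s < T \<Longrightarrow> x + s *\<^sub>R h \<in> interior X"
    using ray_to_frontier[OF bounded x h] by metis
  define u where "u s = grad F (x + s *\<^sub>R h) \<bullet> h" for s
  have flat: "h \<bullet> (hessian F (x + s *\<^sub>R h) *v h) \<le> 0" if s: "0 \<le> s" "s < T" for s
  proof (rule gronwall_nonneg[OF s(1)])
    fix q assume "0 \<le> q" "q \<le> s"
    then have "x + q *\<^sub>R h \<in> interior X" using s int by simp
    then show "((\<lambda>s. h \<bullet> (hessian F (x + s *\<^sub>R h) *v h)) has_real_derivative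
          third_deriv F (x + q *\<^sub>R h) h h h) (at q)"
      and "0 \<le> h \<bullet> (hessian F (x + q *\<^sub>R h) *v h)"
      and "\<bar>third_deriv F (x + q *\<^sub>R h) h h h\<bar>
          \<le> 2 * (h \<bullet> (hessian F (x + q *\<^sub>R h) *v h)) powr (3/2)"
      by (rule line_deriv3 hessian_nonneg third_deriv_bound)+
  next
    fix K assume "h \<bullet> (hessian F (x + s *\<^sub>R h) *v h)
        \<le> h \<bullet> (hessian F (x + 0 *\<^sub>R h) *v h) * exp (K * s)"
    then show ?thesis by (simp add: zero)
  qed
  have u: "u s \<le> u 0" if s: "0 \<le> s" "s < T" for s
    using s(1)
  proof (rule DERIV_nonpos_imp_nonincreasing)
    fix q assume "0 \<le> q" "q \<le> s"
    with s flat[of q] int[of q] line_deriv2[of x q h]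
    show "\<exists>y. (u has_real_derivative y) (at q) \<and> y \<le> 0" unfolding u_def by auto
  qed
  define c where "c = F x + T * \<bar>u 0\<bar>"
  have upper: "F (x + s *\<^sub>R h) \<le> c" if s: "0 \<le> s" "s < T" for s
  proof -
    have "F (x + s *\<^sub>R h) - s * u 0 \<le> F (x + 0 *\<^sub>R h) - 0 * u 0"
    proof (rule DERIV_nonpos_imp_nonincreasing[OF s(1)])
      fix q assume q: "0 \<le> q" "q \<le> s"
      have "((\<lambda>s. F (x + s *\<^sub>R h) - s * u 0) has_real_derivative u q - u 0) (at q)"
        using line_deriv[of x q h] int[of q] q s
        by (auto intro!: derivative_eq_intros simp: u_def)
      with u[of q] q s
      show "\<exists>y. ((\<lambda>s. F (x + s *\<^sub>R h) - s * u 0) has_real_derivative y) (at q) \<and> y \<le> 0"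
        by auto
    qed
    moreover have "s * u 0 \<le> s * \<bar>u 0\<bar>" using s by (intro mult_left_mono) auto
    moreover have "s * \<bar>u 0\<bar> \<le> T * \<bar>u 0\<bar>" using s by (intro mult_right_mono) auto
    ultimately show ?thesis by (simp add: c_def)
  qed
  have "filterlim F at_top (at (x + T *\<^sub>R h) within interior X)"
    using barrier front by (simp add: self_concordant_barrier_def)
  moreover have "filterlim (\<lambda>s. x + s *\<^sub>R h) (at (x + T *\<^sub>R h) within interior X) (at_left T)"
    unfolding filterlim_at
  proof
    have "((\<lambda>s. x + s *\<^sub>R h) \<longlongrightarrow> x + T *\<^sub>R h) (at T within {..<T})"
      by (intro tendsto_intros)
    then show "((\<lambda>s. x + s *\<^sub>R h) \<longlongrightarrow> x + T *\<^sub>R h) (at_left T)" .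
    have "\<forall>\<^sub>F s in at_left T. 0 < s \<and> s < T"
      using T by (auto simp: eventually_at_left intro!: exI[of _ 0])
    then show "\<forall>\<^sub>F s in at_left T. x + s *\<^sub>R h \<in> interior X \<and> x + s *\<^sub>R h \<noteq> x + T *\<^sub>R h"
      by eventually_elim (use int h in auto)
  qed
  ultimately have "filterlim (\<lambda>s. F (x + s *\<^sub>R h)) at_top (at_left T)"
    by (rule filterlim_compose)
  then have "\<forall>\<^sub>F s in at_left T. c < F (x + s *\<^sub>R h)"
    by (simp add: filterlim_at_top_dense)
  moreover have "\<forall>\<^sub>F s in at_left T. 0 < s \<and> s < T"
    using T by (auto simp: eventually_at_left intro!: exI[of _ 0])
  ultimately have "\<forall>\<^sub>F s in at_left T. False"
    by eventually_elim (meson less_imp_le not_le upper)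
  then show False by (simp add: trivial_limit_at_left_real eventually_False)
qed

lemma self_concordant_lower_bound:
  assumes x: "x \<in> interior X" and z: "z \<in> interior X"
  shows "F x + grad F x \<bullet> (z - x) + omega (local_norm F x (z - x)) \<le> F z"
proof -
  have int: "x + s *\<^sub>R (z - x) \<in> interior X" if "0 \<le> s" "s \<le> 1" for s
    using segment_in_interior[of x z s] x z that interior_subset by (cases "s = 1") auto
  show ?thesis
    using self_concordant_line_lower_bound[of "\<lambda>s. F (x + s *\<^sub>R (z - x))" "\<lambda>s. grad F (x + s *\<^sub>R (z - x)) \<bullet> (z - x)"
        "\<lambda>s. (z - x) \<bullet> (hessian F (x + s *\<^sub>R (z - x)) *v (z - x))"
        "\<lambda>s. third_deriv F (x + s *\<^sub>R (z - x)) (z - x) (z - x) (z - x)"]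
      line_derivatives hessian_nonneg third_deriv_bound int
    by (simp add: local_norm_def)
qed

text \<open>The dimension is at least one, so there is a direction along which the barrier inequality can be
  tested, and the Hessian is positive in that direction.\<close>

lemma parameter_nonneg: "0 \<le> \<nu>"
proof -
  obtain x where x: "x \<in> interior X" using interior_nonempty by blast
  obtain h :: "real^'n" where h: "h \<noteq> 0" by (metis axis_eq_0_iff zero_neq_one)
  have "0 \<le> \<nu> * (h \<bullet> (hessian F x *v h))"
    using barrier_parameter_bound[OF x, of h] by (meson order_trans zero_le_power2)
  then show ?thesis
    using hessian_positive_definite[OF x h] by (simp add: zero_le_mult_iff)
qed

text \<open>A boundary point \<open>z\<close> cannot be used as the end of a segment on which \<open>F\<close> is differentiable. The
  interior points \<open>x + p (z - x)\<close> with \<open>p < 1\<close> can, they only scale the inner product by \<open>p\<close>, and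
  \<open>p\<close> may be arbitrarily close to one.\<close>

lemma grad_inner_le_parameter:
  assumes x: "x \<in> interior X" and z: "z \<in> X"
  shows "grad F x \<bullet> (z - x) \<le> \<nu>"
proof -
  have step: "p * (grad F x \<bullet> (z - x)) \<le> \<nu>" if p: "0 < p" "p < 1" for p
  proof -
    let ?h = "p *\<^sub>R (z - x)"
    have int: "x + s *\<^sub>R ?h \<in> interior X" if s: "0 \<le> s" "s \<le> 1" for s
    proof -
      have "s * p < 1" using p s mult_right_mono[of s 1 p] by linarith
      then show ?thesis using segment_in_interior[OF x z, of "s * p"] p s by simp
    qed
    have "grad F (x + 0 *\<^sub>R ?h) \<bullet> ?h \<le> \<nu>"
      using parameter_nonneg line_deriv2 hessian_nonneg barrier_parameter_bound int
      by (intro barrier_line_slope_le[of \<nu> "\<lambda>s. grad F (x + s *\<^sub>R ?h) \<bullet> ?h"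
            "\<lambda>s. ?h \<bullet> (hessian F (x + s *\<^sub>R ?h) *v ?h)"]) blast+
    then show ?thesis by simp
  qed
  show ?thesis
  proof (rule field_le_mult_one_interval)
    fix p :: real assume "0 < p" "p < 1"
    then show "p * (grad F x \<bullet> (z - x)) \<le> \<nu>" by (rule step)
  qed
qed

text \<open>With \<open>w\<close> the solution of \<open>hessian F x *v w = grad F x\<close>, this is the Cauchy-Schwarz inequality of
  the Hessian form for \<open>h\<close> and \<open>w\<close>, since the Newton decrement is the local norm of \<open>w\<close>.\<close>

lemma abs_grad_inner_le:
  assumes x: "x \<in> interior X"
  shows "\<bar>grad F x \<bullet> h\<bar> \<le> newton_decrement F x * local_norm F x h"
proof -
  let ?M = "hessian F x"
  have "invertible ?M"
    unfolding invertible_left_inverse matrix_left_invertible_ker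
    using hessian_positive_definite[OF x] by (metis inner_zero_right less_irrefl)
  then have inv: "?M ** matrix_inv ?M = mat 1"
    unfolding matrix_inv_def invertible_def by (metis (mono_tags, lifting) someI_ex)
  define w where "w = matrix_inv ?M *v grad F x"
  have w: "?M *v w = grad F x"
    unfolding w_def by (simp add: matrix_vector_mul_assoc inv)
  have "(h \<bullet> (?M *v w))\<^sup>2 \<le> (h \<bullet> (?M *v h)) * (w \<bullet> (?M *v w))"
    by (intro nonneg_form_Cauchy_Schwarz hessian_symmetric[OF x] hessian_nonneg[OF x])
  then have "sqrt ((grad F x \<bullet> h)\<^sup>2) \<le> sqrt ((grad F x \<bullet> w) * (h \<bullet> (?M *v h)))"
    unfolding w by (intro real_sqrt_le_mono) (simp add: inner_commute mult.commute)
  then show ?thesis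
    by (simp add: newton_decrement_def dual_local_norm_def local_norm_def real_sqrt_mult w_def)
qed

text \<open>The lower bound of \<open>F\<close> seen from \<open>x\<close> loses at most \<open>\<lambda> r - omega r\<close>, where \<open>r\<close> is the local
  distance of \<open>z\<close>, and conjugacy bounds this by a quantity independent of \<open>z\<close>.\<close>

lemma barrier_gap_le_omega_star:
  assumes x: "x \<in> interior X" and z: "z \<in> interior X" and dec: "newton_decrement F x < 1"
  shows "F x - F z \<le> omega_star (newton_decrement F x)"
proof -
  let ?r = "local_norm F x (z - x)" and ?l = "newton_decrement F x"
  have "0 \<le> ?r" using hessian_nonneg[OF x] by (simp add: local_norm_def)
  then have "?l * ?r \<le> omega ?r + omega_star ?l" using dec by (rule omega_fenchel_young)
  moreover have "- (grad F x \<bullet> (z - x)) \<le> ?l * ?r"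
    using abs_grad_inner_le[OF x, of "z - x"] by simp
  ultimately show ?thesis using self_concordant_lower_bound[OF x z] by simp
qed

section \<open>Analytic centers and maximizers of penalized functions\<close>

lemma continuous_on_barrier: "continuous_on (interior X) F"
  by (intro continuous_at_imp_continuous_on ballI
      has_derivative_continuous[OF GDERIV_grad[unfolded gderiv_def]])

text \<open>A limit point of the sublevel set lies in \<open>X\<close>; it cannot lie on the boundary, where \<open>F\<close> tends to
  infinity, and in the interior continuity of \<open>F\<close> keeps the bound.\<close>

lemma compact_barrier_sublevel: "compact {x \<in> interior X. F x \<le> c}"
proof -
  let ?K = "{x \<in> interior X. F x \<le> c}"
  have "closed ?K"
    unfolding closed_limpt
  proof (intro allI impI)
    fix x assume lim: "x islimpt ?K"
    have "x \<in> X"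
      using islimpt_subset[OF lim, of X] closed interior_subset closed_limpt by blast
    have freq: "\<exists>\<^sub>F z in at x within interior X. F z \<le> c"
      using lim by (simp add: islimpt_conv_frequently_at frequently_def eventually_at_filter)
    show "x \<in> ?K"
    proof (cases "x \<in> interior X")
      case True
      then have "(F \<longlongrightarrow> F x) (at x within interior X)"
        using continuous_on_barrier by (simp add: continuous_on_def)
      have "F x \<le> c"
      proof (rule ccontr)
        assume "\<not> F x \<le> c"
        then have "\<forall>\<^sub>F z in at x within interior X. c < F z"
          using order_tendstoD(1)[OF \<open>(F \<longlongrightarrow> F x) _\<close>] by simp
        then show False using freq by (simp add: frequently_def not_le)
      qed
      then show ?thesis using True by simp
    next
      case False
      then have "x \<in> frontier X" using \<open>x \<in> X\<close> closure_subset by (auto simp: frontier_def)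
      then have "filterlim F at_top (at x within interior X)"
        using barrier by (simp add: self_concordant_barrier_def)
      then have "\<forall>\<^sub>F z in at x within interior X. c < F z" by (simp add: filterlim_at_top_dense)
      then show ?thesis using freq by (simp add: frequently_def not_le)
    qed
  qed
  moreover have "bounded ?K" using bounded by (rule bounded_subset) (use interior_subset in auto)
  ultimately show ?thesis by (simp add: compact_eq_bounded_closed)
qed

text \<open>Since \<open>g\<close> is bounded above on the compact body, points with a large barrier value are worse than any
  given interior point. The search is thereby confined to a compact sublevel set of \<open>F\<close>.\<close>

lemma penalized_max_attained:
  assumes g: "upper_semicontinuous_on X g" and t: "0 < t"
  shows "\<exists>x\<in>interior X. \<forall>z\<in>interior X. g z - t * F z \<le> g x - t * F x"
proof -
  obtain x0 where x0: "x0 \<in> interior X" using interior_nonempty by blast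
  then have "X \<noteq> {}" using interior_subset by blast
  then obtain m where m: "\<And>z. z \<in> X \<Longrightarrow> g z \<le> g m"
    using upper_semicontinuous_attains_sup[OF compact _ g] by blast
  \<comment> \<open>Where \<open>F > c\<close>, already the upper bound \<open>g m - t F\<close> of the objective is below its value at \<open>x0\<close>.\<close>
  define c where "c = F x0 + (g m - g x0) / t"
  let ?K = "{x \<in> interior X. F x \<le> c}"
  have x0K: "x0 \<in> ?K" using x0 m[of x0] interior_subset[of X] t by (auto simp: c_def)
  have "upper_semicontinuous_on ?K (\<lambda>x. g x + (- t * F x))"
    using interior_subset
    by (intro upper_semicontinuous_on_add_continuous upper_semicontinuous_on_subset[OF g]
        continuous_intros continuous_on_subset[OF continuous_on_barrier]) auto
  then obtain x where x: "x \<in> ?K" "\<And>z. z \<in> ?K \<Longrightarrow> g z - t * F z \<le> g x - t * F x"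
    using upper_semicontinuous_attains_sup[OF compact_barrier_sublevel] x0K by fastforce
  have "g z - t * F z \<le> g x - t * F x" if z: "z \<in> interior X" for z
  proof (cases "F z \<le> c")
    case True
    then show ?thesis using x(2) z by simp
  next
    case False
    then have "t * c \<le> t * F z" using t by simp
    moreover have "t * c = t * F x0 + (g m - g x0)" using t by (simp add: c_def field_simps)
    moreover have "g z \<le> g m" using m z interior_subset by blast
    ultimately show ?thesis using x(2)[OF x0K] by simp
  qed
  then show ?thesis using x(1) by blast
qed

lemma analytic_center:
  shows analytic_center_interior: "analytic_center X F \<in> interior X"
    and analytic_center_minimal: "z \<in> interior X \<Longrightarrow> F (analytic_center X F) \<le> F z"
proof -
  \<comment> \<open>Minimizing \<open>F\<close> is the penalized problem with zero objective and unit penalty.\<close>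
  have "upper_semicontinuous_on X (\<lambda>_. 0)" by (simp add: upper_semicontinuous_on_def)
  from penalized_max_attained[OF this, of 1]
  have *: "\<exists>x\<in>interior X. \<forall>z\<in>interior X. F x \<le> F z" by simp
  show "analytic_center X F \<in> interior X" "z \<in> interior X \<Longrightarrow> F (analytic_center X F) \<le> F z"
    unfolding analytic_center_def using arg_min_on_attained[OF *] by auto
qed

lemma grad_analytic_center: "grad F (analytic_center X F) = 0"
proof -
  let ?c = "analytic_center X F"
  have "(\<lambda>h. h \<bullet> grad F ?c) = (\<lambda>h. 0)"
    using analytic_center_interior analytic_center_minimal
    by (intro differential_zero_maxmin[of ?c "interior X" F]
        GDERIV_grad[OF analytic_center_interior, unfolded gderiv_def]) auto
  then show ?thesis by (metis inner_eq_zero_iff)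
qed

lemma omega_center_distance_le:
  assumes "z \<in> interior X"
  shows "omega (local_norm F (analytic_center X F) (z - analytic_center X F))
           \<le> F z - F (analytic_center X F)"
  using self_concordant_lower_bound[OF analytic_center_interior assms]
  by (simp add: grad_analytic_center)

section \<open>The smoothing gap\<close>

text \<open>Concavity of \<open>g\<close> gives a gain of at least \<open>s (g z - g x)\<close> at the point \<open>x + s (z - x)\<close>, and
  maximality of \<open>x\<close> says that the penalty, \<open>t\<close> times the increase of \<open>F\<close>, is at least this gain.
  As \<open>s\<close> tends to zero, the difference quotient of \<open>F\<close> becomes the slope towards \<open>z\<close>.\<close>

lemma penalized_maximizer_gap:
  assumes g: "concave_on X g" and t: "0 < t" and x: "x \<in> interior X"
    and max: "\<And>z. z \<in> interior X \<Longrightarrow> g z - t * F z \<le> g x - t * F x"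
    and z: "z \<in> X"
  shows "g z - g x \<le> t * \<nu>"
proof -
  let ?h = "z - x"
  have ineq: "(g z - g x) / t \<le> (F (x + s *\<^sub>R ?h) - F x) / s" if s: "0 < s" "s < 1" for s
  proof -
    have "(1 - s) * g x + s * g z \<le> g ((1 - s) *\<^sub>R x + s *\<^sub>R z)"
      using concave_onD[OF g, of s x z] s x z interior_subset by auto
    also have "(1 - s) *\<^sub>R x + s *\<^sub>R z = x + s *\<^sub>R ?h" by (simp add: algebra_simps)
    finally have "s * (g z - g x) \<le> g (x + s *\<^sub>R ?h) - g x" by (simp add: algebra_simps)
    also have "\<dots> \<le> t * (F (x + s *\<^sub>R ?h) - F x)"
      using max[OF segment_in_interior[OF x z, of s]] s by (simp add: algebra_simps)
    finally show ?thesis using s t by (simp add: field_simps)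
  qed
  have "((\<lambda>s. F (x + s *\<^sub>R ?h)) has_real_derivative grad F x \<bullet> ?h) (at 0)"
    using line_deriv[of x 0 ?h] x by simp
  then have "((\<lambda>s. (F (x + s *\<^sub>R ?h) - F x) / s) \<longlongrightarrow> grad F x \<bullet> ?h) (at 0)"
    by (simp add: DERIV_def)
  then have "((\<lambda>s. (F (x + s *\<^sub>R ?h) - F x) / s) \<longlongrightarrow> grad F x \<bullet> ?h) (at_right 0)"
    by (rule tendsto_within_subset) simp
  moreover have "\<forall>\<^sub>F s in at_right 0. (g z - g x) / t \<le> (F (x + s *\<^sub>R ?h) - F x) / s"
    unfolding eventually_at_right_field by (intro exI[of _ 1]) (use ineq in auto)
  ultimately have "(g z - g x) / t \<le> grad F x \<bullet> ?h"
    by (intro tendsto_lowerbound) auto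
  also have "\<dots> \<le> \<nu>" using grad_inner_le_parameter[OF x z] .
  finally show ?thesis using t by (simp add: field_simps)
qed

text \<open>The gap of one block is \<open>(max g - g xs) + t (F xs - F xc)\<close>: the constant shift \<open>t F xc\<close> does not
  change the maximizer \<open>xs\<close> and reappears in the value. The bounds on the two summands are added.\<close>

lemma smoothed_component_gap:
  fixes \<phi> :: "real^'n \<Rightarrow> real" and A :: "real^'n^'m" and y :: "real^'m" and t :: real
  defines "g \<equiv> \<lambda>x. \<phi> x + y \<bullet> (A *v x)"
    and "xc \<equiv> analytic_center X F"
    and "xs \<equiv> smoothed_maximizer X F \<phi> A y t"
  assumes \<phi>: "concave_on X \<phi>" "upper_semicontinuous_on X \<phi>" and t: "0 < t"
    and dec: "newton_decrement F xs < 1"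
  shows "\<exists>x\<in>X. \<forall>z\<in>X. g z \<le> g x"
    and "0 \<le> omega (local_norm F xc (xs - xc))"
    and "t * omega (local_norm F xc (xs - xc))
           \<le> max_over X g - smoothed_dual_component X F \<phi> A y t"
    and "max_over X g - smoothed_dual_component X F \<phi> A y t
           \<le> t * (omega_star (newton_decrement F xs) + \<nu>)"
proof -
  have lin: "linear (\<lambda>x. y \<bullet> (A *v x))"
    by (intro linearI) (simp_all add: matrix_vector_right_distrib inner_add_right matrix_vector_mult_scaleR)
  have usc: "upper_semicontinuous_on X g"
    unfolding g_def
    by (intro upper_semicontinuous_on_add_continuous \<phi> linear_continuous_on)
       (simp add: lin linear_conv_bounded_linear[symmetric])
  have "concave_on X (\<lambda>x. y \<bullet> (A *v x))"
    using convex by (simp add: concave_on_iff matrix_vector_right_distrib inner_add_right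
        matrix_vector_mult_scaleR)
  then have conc: "concave_on X g"
    unfolding g_def using \<phi>(1) by (rule concave_on_add[rotated])
  have obj: "smoothed_objective X F \<phi> A y t x = (g x - t * F x) + t * F xc" for x
    by (simp add: smoothed_objective_def g_def xc_def algebra_simps)
  have "X \<noteq> {}" using interior_nonempty interior_subset by blast
  then show att: "\<exists>x\<in>X. \<forall>z\<in>X. g z \<le> g x"
    using upper_semicontinuous_attains_sup[OF compact _ usc] by blast
  have "\<exists>x\<in>interior X. \<forall>z\<in>interior X.
      smoothed_objective X F \<phi> A y t z \<le> smoothed_objective X F \<phi> A y t x"
    using penalized_max_attained[OF usc t] by (simp add: obj)
  note xs = arg_max_on_attained[OF this, folded smoothed_maximizer_def, folded xs_def]
  have xs_max: "g z - t * F z \<le> g xs - t * F xs" if "z \<in> interior X" for z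
    using xs(2)[OF that] by (simp add: obj)
  have comp: "smoothed_dual_component X F \<phi> A y t = g xs - t * (F xs - F xc)"
    unfolding smoothed_dual_component_def
    using max_over_eqI[of xs "interior X" "smoothed_objective X F \<phi> A y t"] xs
    by (simp add: obj algebra_simps)
  obtain x where x: "x \<in> X" "\<And>z. z \<in> X \<Longrightarrow> g z \<le> g x" using att by blast
  then have max: "max_over X g = g x" by (rule max_over_eqI)
  have xc: "xc \<in> interior X" unfolding xc_def by (rule analytic_center_interior)
  show "0 \<le> omega (local_norm F xc (xs - xc))"
    using hessian_nonneg[OF xc] by (intro omega_nonneg) (simp add: local_norm_def)
  have "t * omega (local_norm F xc (xs - xc)) \<le> t * (F xs - F xc)"
    using omega_center_distance_le[OF xs(1), folded xc_def] t by simp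
  moreover have "g xs \<le> g x" using x(2) xs(1) interior_subset by blast
  ultimately show "t * omega (local_norm F xc (xs - xc))
           \<le> max_over X g - smoothed_dual_component X F \<phi> A y t"
    by (simp add: max comp)
  have "t * (F xs - F xc) \<le> t * omega_star (newton_decrement F xs)"
    using barrier_gap_le_omega_star[OF xs(1) xc dec] t by simp
  moreover have "g x - g xs \<le> t * \<nu>"
    using penalized_maximizer_gap[OF conc t xs(1) xs_max x(1)] by blast
  ultimately show "max_over X g - smoothed_dual_component X F \<phi> A y t
           \<le> t * (omega_star (newton_decrement F xs) + \<nu>)"
    by (simp add: max comp distrib_left)
qed

end

text \<open>A sum of functions of separate variables is maximal at a pair of maximizers; attainment in each block
  makes the values computed by the definition of a maximum additive.\<close>

lemma dual_fun_separable:
  fixes \<phi>1 :: "real^'n1 \<Rightarrow> real" and \<phi>2 :: "real^'n2 \<Rightarrow> real" and b y :: "real^'m"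
  assumes "\<exists>x\<in>X1. \<forall>z\<in>X1. \<phi>1 z + y \<bullet> (A1 *v z) \<le> \<phi>1 x + y \<bullet> (A1 *v x)"
    and "\<exists>x\<in>X2. \<forall>z\<in>X2. \<phi>2 z + y \<bullet> (A2 *v z) \<le> \<phi>2 x + y \<bullet> (A2 *v x)"
  shows "dual_fun X1 X2 \<phi>1 \<phi>2 A1 A2 b y
    = max_over X1 (\<lambda>x. \<phi>1 x + y \<bullet> (A1 *v x)) + max_over X2 (\<lambda>x. \<phi>2 x + y \<bullet> (A2 *v x)) - b \<bullet> y"
proof -
  obtain x1 where x1: "x1 \<in> X1" "\<And>z. z \<in> X1 \<Longrightarrow> \<phi>1 z + y \<bullet> (A1 *v z) \<le> \<phi>1 x1 + y \<bullet> (A1 *v x1)"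
    using assms(1) by blast
  obtain x2 where x2: "x2 \<in> X2" "\<And>z. z \<in> X2 \<Longrightarrow> \<phi>2 z + y \<bullet> (A2 *v z) \<le> \<phi>2 x2 + y \<bullet> (A2 *v x2)"
    using assms(2) by blast
  have "dual_fun X1 X2 \<phi>1 \<phi>2 A1 A2 b y
      = (case (x1, x2) of (x1, x2) \<Rightarrow> \<phi>1 x1 + \<phi>2 x2 + y \<bullet> (A1 *v x1 + A2 *v x2 - b))"
    unfolding dual_fun_def
  proof (rule max_over_eqI)
    show "(x1, x2) \<in> X1 \<times> X2" using x1 x2 by simp
    fix z assume "z \<in> X1 \<times> X2"
    then show "(case z of (x1, x2) \<Rightarrow> \<phi>1 x1 + \<phi>2 x2 + y \<bullet> (A1 *v x1 + A2 *v x2 - b))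
        \<le> (case (x1, x2) of (x1, x2) \<Rightarrow> \<phi>1 x1 + \<phi>2 x2 + y \<bullet> (A1 *v x1 + A2 *v x2 - b))"
      using x1(2)[of "fst z"] x2(2)[of "snd z"]
      by (auto simp: inner_add_right inner_diff_right)
  qed
  moreover have "max_over X1 (\<lambda>x. \<phi>1 x + y \<bullet> (A1 *v x)) = \<phi>1 x1 + y \<bullet> (A1 *v x1)"
    using x1 by (intro max_over_eqI[of x1 X1 "\<lambda>x. \<phi>1 x + y \<bullet> (A1 *v x)"]) auto
  moreover have "max_over X2 (\<lambda>x. \<phi>2 x + y \<bullet> (A2 *v x)) = \<phi>2 x2 + y \<bullet> (A2 *v x2)"
    using x2 by (intro max_over_eqI[of x2 X2 "\<lambda>x. \<phi>2 x + y \<bullet> (A2 *v x)"]) auto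
  ultimately show ?thesis by (simp add: inner_add_right inner_diff_right inner_commute)
qed

theorem lemma3p1:
  fixes X1 :: "(real^'n1) set" and X2 :: "(real^'n2) set"
    and F1 \<phi>1 :: "real^'n1 \<Rightarrow> real" and F2 \<phi>2 :: "real^'n2 \<Rightarrow> real"
    and \<nu>1 \<nu>2 :: real
    and A1 :: "real^'n1^'m" and A2 :: "real^'n2^'m"
    and b y :: "real^'m"
    and \<beta> t :: real
  assumes "bounded X1" "closed X1" "convex X1" "interior X1 \<noteq> {}"
    and "bounded X2" "closed X2" "convex X2" "interior X2 \<noteq> {}"
    and "self_concordant_barrier X1 \<nu>1 F1"
    and "self_concordant_barrier X2 \<nu>2 F2"
    and "concave_on X1 \<phi>1" "upper_semicontinuous_on X1 \<phi>1"
    and "concave_on X2 \<phi>2" "upper_semicontinuous_on X2 \<phi>2"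
    and "rank (hcat A1 A2) = CARD('m)"
    and "\<exists>x. is_arg_max (\<lambda>(x1, x2). \<phi>1 x1 + \<phi>2 x2)
               (\<lambda>(x1, x2). A1 *v x1 + A2 *v x2 = b \<and> (x1, x2) \<in> X1 \<times> X2) x"
    and "rel_interior (X1 \<times> X2) \<inter> {(x1, x2). A1 *v x1 + A2 *v x2 = b} \<noteq> {}
         \<or> polyhedron (X1 \<times> X2)"
    and "0 < \<beta>" "\<beta> < 1" "0 < t"
    and "y \<in> center_nbhd X1 F1 \<phi>1 A1 t \<beta> \<inter> center_nbhd X2 F2 \<phi>2 A2 t \<beta>"
  defines "xc1 \<equiv> analytic_center X1 F1"
    and "xc2 \<equiv> analytic_center X2 F2"
    and "xs1 \<equiv> smoothed_maximizer X1 F1 \<phi>1 A1 y t"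
    and "xs2 \<equiv> smoothed_maximizer X2 F2 \<phi>2 A2 y t"
    and "gap \<equiv> dual_fun X1 X2 \<phi>1 \<phi>2 A1 A2 b y
                 - smoothed_dual X1 X2 F1 F2 \<phi>1 \<phi>2 A1 A2 b y t"
  shows "0 \<le> t * (omega (local_norm F1 xc1 (xs1 - xc1)) + omega (local_norm F2 xc2 (xs2 - xc2)))
    \<and> t * (omega (local_norm F1 xc1 (xs1 - xc1)) + omega (local_norm F2 xc2 (xs2 - xc2))) \<le> gap
    \<and> gap \<le> t * ((omega_star (newton_decrement F1 xs1) + \<nu>1)
                 + (omega_star (newton_decrement F2 xs2) + \<nu>2))"
proof -
  interpret B1: barrier_body X1 F1 \<nu>1 by unfold_locales (use assms in auto)
  interpret B2: barrier_body X2 F2 \<nu>2 by unfold_locales (use assms in auto)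
  have dec: "newton_decrement F1 xs1 < 1" "newton_decrement F2 xs2 < 1"
    using assms(19,21) by (auto simp: center_nbhd_def xs1_def xs2_def)
  note C1 = B1.smoothed_component_gap[OF assms(11,12,20) dec(1)[unfolded xs1_def],
      folded xs1_def xc1_def]
  note C2 = B2.smoothed_component_gap[OF assms(13,14,20) dec(2)[unfolded xs2_def],
      folded xs2_def xc2_def]
  have gap: "gap =
      (max_over X1 (\<lambda>x. \<phi>1 x + y \<bullet> (A1 *v x)) - smoothed_dual_component X1 F1 \<phi>1 A1 y t)
    + (max_over X2 (\<lambda>x. \<phi>2 x + y \<bullet> (A2 *v x)) - smoothed_dual_component X2 F2 \<phi>2 A2 y t)"
    unfolding gap_def dual_fun_separable[OF C1(1) C2(1)] smoothed_dual_def by simp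
  have "0 \<le> t * (omega (local_norm F1 xc1 (xs1 - xc1)) + omega (local_norm F2 xc2 (xs2 - xc2)))"
    using C1(2) C2(2) assms(20) by simp
  then show ?thesis
    using C1(3,4) C2(3,4) unfolding gap distrib_left by linarith
qed

end
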